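(* Let $a,b>0$ with $a+b\leq 1$, and let $c\geq 0$. Define on $(0,1)$ $$\varphi_{a,b,c}(x)=\frac{c-\log(1-x)}{{}_2F_1(a,b;a+b;x)}.$$ Then $\varphi_{a,b,c}$ is strictly convex on $(0,1)$ if and only if $c\leq R(a,b)$, and $\varphi_{a,b,c}$ is strictly concave on $(0,1)$ if and only if $c\geq c(a,b)$, where $$c(a,b)=\frac{(a+b)(a+b-2ab)(a+b+1)}{ab\big((a+b+1)(a+b-2ab)+ab(a+b)\big)}.$$
   Context: ${}_2F_1(a,b;c;x)=\sum_{n\geq0}\frac{(a)_n(b)_n}{(c)_n}\frac{x^n}{n!}$ is the Gauss hypergeometric function, with $(a)_n=\Gamma(a+n)/\Gamma(a)$ the Pochhammer symbol. $\psi=\Gamma'/\Gamma$ is the digamma function, $\gamma=-\psi(1)$ the Euler–Mascheroni constant, and $R(a,b)=-2\gamma-\psi(a)-\psi(b)$ (the Ramanujan constant). *)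

theory Defs
  imports "HOL-Analysis.Analysis"
begin

definition hyp2F1 :: "real \<Rightarrow> real \<Rightarrow> real \<Rightarrow> real \<Rightarrow> real" where
  "hyp2F1 a b c x =
     (\<Sum>n. pochhammer a n * pochhammer b n / pochhammer c n * x ^ n / fact n)"

definition ramanujanR :: "real \<Rightarrow> real \<Rightarrow> real" where
  "ramanujanR a b = - 2 * euler_mascheroni - Digamma a - Digamma b"

definition strictly_convex_on :: "real set \<Rightarrow> (real \<Rightarrow> real) \<Rightarrow> bool" where
  "strictly_convex_on S f \<longleftrightarrow>
     (\<forall>x\<in>S. \<forall>y\<in>S. x \<noteq> y \<longrightarrow> (\<forall>t. 0 < t \<and> t < 1 \<longrightarrow>
        f ((1 - t) * x + t * y) < (1 - t) * f x + t * f y))"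

definition strictly_concave_on :: "real set \<Rightarrow> (real \<Rightarrow> real) \<Rightarrow> bool" where
  "strictly_concave_on S f \<longleftrightarrow> strictly_convex_on S (\<lambda>x. - f x)"

definition phi_abc :: "real \<Rightarrow> real \<Rightarrow> real \<Rightarrow> real \<Rightarrow> real" where
  "phi_abc a b c x = (c - ln (1 - x)) / hyp2F1 a b (a + b) x"

definition c_ab :: "real \<Rightarrow> real \<Rightarrow> real" where
  "c_ab a b = (a + b) * (a + b - 2 * a * b) * (a + b + 1) /
     (a * b * ((a + b + 1) * (a + b - 2 * a * b) + a * b * (a + b)))"

end

theory Submission
  imports Defs "HOL-Real_Asymp.Real_Asymp"
begin

text \<open>
  Write \<open>F\<close> for \<open>B(a,b)\<close> times the hypergeometric function, \<open>D = (1 - x) F'\<close>, \<open>p = a b\<close> and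
  \<open>s = a + b\<close>. The hypergeometric equation becomes \<open>x D' = p F - s D\<close>, and \<open>D\<close> has positive
  coefficients. The second derivative of \<open>(c - ln (1 - x)) / F\<close> is a positive function times
  \<open>h - c\<close> with \<open>h\<close> independent of \<open>c\<close>, so everything follows once \<open>h\<close> decreases strictly from
  \<open>h(0+) = c(a,b)\<close> to \<open>h(1-) = R(a,b)\<close>.

  In terms of \<open>w = F / D\<close> and \<open>q = (1 - x) D' / D\<close>, which satisfy
  \<open>(1 - x) w' = 1 - q w\<close> and \<open>q = (1 - x) (p w - s) / x\<close>, the sign of \<open>h'\<close> is that of \<open>E - (s - 2 p)\<close>
  where \<open>E = q ((s + 1 - 3 p) w - (2 - s))\<close>. Since \<open>E(0) = s - 2 p\<close> and \<open>E' < 0\<close> wherever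
  \<open>E \<ge> s - 2 p\<close>, a barrier argument gives \<open>E < s - 2 p\<close> on the whole interval.

  The limit at 1 rests on \<open>F(x) + ln (1 - x) \<longlongrightarrow> R(a,b)\<close>. The constant is identified as in the
  Bohr-Mollerup theorem: as a function of \<open>a\<close> it is decreasing, drops by \<open>1/a\<close> under
  \<open>a \<mapsto> a + 1\<close>, and is explicit at \<open>a = 1\<close>.
\<close>

section \<open>The Ramanujan constant as a series\<close>

text \<open>The Taylor coefficients of \<open>Beta a b * hyp2F1 a b (a + b)\<close>.\<close>

definition zb_term :: "real \<Rightarrow> real \<Rightarrow> nat \<Rightarrow> real" where
  "zb_term a b n = Gamma (a + real n) * Gamma (b + real n) / (Gamma (a + b + real n) * fact n)"

section \<open>The coefficients: recurrence, telescoping and growth\<close>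

lemma Gamma_real_nonzero: "x > 0 \<Longrightarrow> Gamma (x :: real) \<noteq> 0"
  using Gamma_real_pos[of x] by linarith

lemma zb_term_pos:
  assumes "a > 0" "b > 0"
  shows "zb_term a b n > 0"
  unfolding zb_term_def using assms by (intro divide_pos_pos mult_pos_pos Gamma_real_pos) auto

lemma zb_term_eq_pochhammer:
  assumes "a > 0" "b > 0"
  shows "zb_term a b n =
           Beta a b * (pochhammer a n * pochhammer b n / pochhammer (a + b) n / fact n)"
proof -
  have "Gamma a \<noteq> 0" "Gamma b \<noteq> 0" "Gamma (a + b) \<noteq> 0" "Gamma (a + b + real n) \<noteq> 0"
    using assms by (auto intro!: Gamma_real_nonzero)
  moreover have "pochhammer z n = Gamma (z + real n) / Gamma z" if "z > 0" for z :: real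
    using that by (intro pochhammer_Gamma) (auto simp: nonpos_Ints_def)
  ultimately show ?thesis
    using assms by (simp add: zb_term_def Beta_def field_simps)
qed

lemma zb_term_Suc:
  assumes "a > 0" "b > 0"
  shows "zb_term a b (Suc n) =
           zb_term a b n * ((a + real n) * (b + real n) / ((a + b + real n) * (real n + 1)))"
proof -
  have "pochhammer (a + b) n > 0" "a + b + real n > 0"
    using assms by (auto intro!: pochhammer_pos add_pos_nonneg)
  then show ?thesis
    using assms by (simp add: zb_term_eq_pochhammer pochhammer_rec' field_simps)
qed

text \<open>By the recurrence, each summand is the increment of
  \<open>real n * zb_term a b n\<close>. This telescoping controls the growth of the coefficients
  and later supplies the coefficients of \<open>D\<close>.\<close>

lemma sum_zb_term_div:
  assumes "a > 0" "b > 0"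
  shows "(\<Sum>k<n. a * b * zb_term a b k / (a + b + real k)) = real n * zb_term a b n"
proof (induction n)
  case (Suc n)
  have pos: "a + b + real n > 0" using assms by auto
  have "real (Suc n) * zb_term a b (Suc n) =
      zb_term a b n * ((a + real n) * (b + real n) / (a + b + real n))"
    by (simp add: zb_term_Suc[OF assms] add.commute[of "real n" 1])
  also have "\<dots> = real n * zb_term a b n + a * b * zb_term a b n / (a + b + real n)"
    using pos by (simp add: divide_simps) (simp add: algebra_simps)
  finally show ?case
    using Suc by simp
qed auto

text \<open>Gauss's product formula for Gamma: up to \<open>Beta a b\<close>, the sequence is a
  quotient of \<open>Gamma_series'\<close> values, and the powers of \<open>n\<close> cancel because
  the lower parameter is \<open>a + b\<close>.\<close>

lemma tendsto_n_zb_term: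
  assumes "a > 0" "b > 0"
  shows "(\<lambda>n. real n * zb_term a b n) \<longlonglongrightarrow> 1"
proof -
  have nz: "Gamma a \<noteq> 0" "Gamma b \<noteq> 0" "Gamma (a + b) \<noteq> 0"
    using assms by (auto intro!: Gamma_real_nonzero)
  have "(\<lambda>n. Beta a b * (Gamma_series' (a + b) n / (Gamma_series' a n * Gamma_series' b n)))
          \<longlonglongrightarrow> Beta a b * (Gamma (a + b) / (Gamma a * Gamma b))"
    using nz assms
    by (intro tendsto_intros Gamma_series'_LIMSEQ) auto
  also have "Beta a b * (Gamma (a + b) / (Gamma a * Gamma b)) = 1"
    using nz by (simp add: Beta_def)
  finally show ?thesis
  proof (rule Lim_transform_eventually)
    show "\<forall>\<^sub>F n in sequentially.
            Beta a b * (Gamma_series' (a + b) n / (Gamma_series' a n * Gamma_series' b n)) =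
            real n * zb_term a b n"
      using eventually_gt_at_top[of 0]
    proof eventually_elim
      case (elim n)
      have "pochhammer a n > 0" "pochhammer b n > 0" "pochhammer (a + b) n > 0"
        using assms by (auto intro!: pochhammer_pos)
      moreover have "fact n = real n * fact (n - 1)"
        using elim by (simp add: fact_reduce)
      moreover have "exp ((a + b) * ln (real n)) = exp (a * ln (real n)) * exp (b * ln (real n))"
        by (simp add: algebra_simps exp_add)
      ultimately show ?case
        using elim by (simp add: zb_term_eq_pochhammer[OF assms] Gamma_series'_def field_simps)
    qed
  qed
qed

text \<open>The telescoping sum has nonnegative summands, so the sequence increases to its limit
  1.\<close>

lemma n_zb_term_le_1:
  assumes "a > 0" "b > 0"
  shows "real n * zb_term a b n \<le> 1"
proof -
  have "incseq (\<lambda>n. real n * zb_term a b n)"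
    unfolding sum_zb_term_div[OF assms, symmetric]
    using zb_term_pos[OF assms] assms
    by (intro incseq_SucI) (auto intro!: divide_nonneg_nonneg mult_nonneg_nonneg less_imp_le)
  then show ?thesis
    using tendsto_n_zb_term[OF assms] by (rule incseq_le)
qed

section \<open>Dependence of the partial sums on the first parameter\<close>

lemma zb_term_antimono:
  assumes "a > 0" "a \<le> a'" "b > 0"
  shows "zb_term a' b n \<le> zb_term a b n"
proof -
  \<comment> \<open>The part of the logarithm of the term that varies with \<open>a\<close>; its
    derivative is a difference of Digamma values, nonpositive by monotonicity.\<close>
  define f where "f = (\<lambda>x. ln_Gamma (x + real n) - ln_Gamma (x + b + real n))"
  have "f a' \<le> f a"
  proof (rule DERIV_nonpos_imp_nonincreasing[OF assms(2)])
    fix x assume x: "a \<le> x" "x \<le> a'"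
    have "(f has_real_derivative (Digamma (x + real n) - Digamma (x + b + real n))) (at x)"
      unfolding f_def using x assms
      by (auto intro!: derivative_eq_intros)
    moreover have "Digamma (x + real n) \<le> Digamma (x + b + real n)"
      using x assms by (intro Digamma_real_mono) auto
    ultimately show "\<exists>y. (f has_real_derivative y) (at x) \<and> y \<le> 0"
      by (intro exI[of _ "Digamma (x + real n) - Digamma (x + b + real n)"]) auto
  qed
  have eq: "zb_term x b n = exp (f x) * (Gamma (b + real n) / fact n)" if "x > 0" for x
    using that assms
    by (simp add: zb_term_def f_def exp_diff Gamma_real_pos_exp)
  have "Gamma (b + real n) / fact n \<ge> 0"
    using assms by (auto intro!: divide_nonneg_pos less_imp_le[OF Gamma_real_pos])
  then have "exp (f a') * (Gamma (b + real n) / fact n) \<le> exp (f a) * (Gamma (b + real n) / fact n)"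
    using \<open>f a' \<le> f a\<close> by (intro mult_right_mono) auto
  then show ?thesis
    using assms by (simp only: eq)
qed

text \<open>Termwise, the difference is \<open>1 / a\<close> times a summand of the telescoping sum.
  By \<open>tendsto_n_zb_term\<close> the right-hand side tends to \<open>1 / a\<close>, which
  matches \<open>Digamma (a + 1) - Digamma a\<close>.\<close>

lemma sum_zb_term_shift:
  assumes "a > 0" "b > 0"
  shows "(\<Sum>k<n. zb_term a b k) - (\<Sum>k<n. zb_term (a + 1) b k) = real n * zb_term a b n / a"
proof -
  have "zb_term a b k - zb_term (a + 1) b k = a * b * zb_term a b k / (a + b + real k) / a" for k
  proof -
    have "a + real k > 0" "a + b + real k > 0" using assms by auto
    then have "Gamma (a + 1 + real k) = (a + real k) * Gamma (a + real k)"
         "Gamma (a + 1 + b + real k) = (a + b + real k) * Gamma (a + b + real k)"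
      using Gamma_plus1[of "a + real k"] Gamma_plus1[of "a + b + real k"]
      by (auto simp: algebra_simps nonpos_Ints_def)
    then have eq: "zb_term (a + 1) b k = zb_term a b k * ((a + real k) / (a + b + real k))"
      by (simp add: zb_term_def mult_ac)
    show ?thesis
      unfolding eq using assms \<open>a + b + real k > 0\<close>
      by (simp add: divide_simps) (simp add: algebra_simps)
  qed
  then show ?thesis
    by (simp only: sum_subtractf[symmetric] sum_divide_distrib[symmetric] sum_zb_term_div[OF assms])
qed

text \<open>The error in approximating the partial sum by
  \<open>ln n - Digamma a - Digamma b - euler_mascheroni\<close>. The fixed parameter
  \<open>b\<close> comes first; \<open>a\<close> is the variable of the Bohr-Mollerup
  argument.\<close>

definition zb_const_err :: "real \<Rightarrow> real \<Rightarrow> nat \<Rightarrow> real" where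
  "zb_const_err b a n = (\<Sum>k<n. zb_term a b k) - ln (real n)
     + Digamma a + Digamma b + euler_mascheroni"

lemma zb_const_err_shift:
  assumes "a > 0" "b > 0"
  shows "(\<lambda>n. zb_const_err b a n - zb_const_err b (a + real N) n) \<longlonglongrightarrow> 0"
proof (induction N)
  case (Suc N)
  have pos: "a + real N > 0" using assms by auto
  have "(\<lambda>n. real n * zb_term (a + real N) b n / (a + real N) - 1 / (a + real N))
          \<longlonglongrightarrow> 1 / (a + real N) - 1 / (a + real N)"
    using pos by (intro tendsto_intros tendsto_n_zb_term assms) auto
  moreover have "zb_const_err b (a + real N) n - zb_const_err b (a + real (Suc N)) n =
      real n * zb_term (a + real N) b n / (a + real N) - 1 / (a + real N)" for n
    using sum_zb_term_shift[OF pos assms(2), of n] Digamma_plus1[of "a + real N"] pos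
    by (simp add: zb_const_err_def algebra_simps)
  ultimately have "(\<lambda>n. zb_const_err b (a + real N) n - zb_const_err b (a + real (Suc N)) n)
      \<longlonglongrightarrow> 0"
    by simp
  from tendsto_add[OF Suc this] show ?case by simp
qed auto

text \<open>For \<open>a = 1\<close> the terms are \<open>1 / (b + k)\<close> and
  \<open>Digamma 1\<close> cancels the Euler constant, so the limit formula for
  \<open>Digamma b\<close> applies. The shift lemma carries this to all positive integers.\<close>

lemma zb_const_err_nat:
  assumes "N > 0" "b > 0"
  shows "zb_const_err b (real N) \<longlonglongrightarrow> 0"
proof -
  have "zb_term 1 b k = inverse (b + real k)" for k
  proof -
    have "Gamma (1 + b + real k) = (b + real k) * Gamma (b + real k)"
      using Gamma_plus1[of "b + real k"] assms by (auto simp: add_ac nonpos_Ints_def)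
    then show ?thesis
      using Gamma_real_nonzero[of "b + real k"] assms
      by (simp add: zb_term_def Gamma_fact inverse_eq_divide)
  qed
  then have "zb_const_err b 1 = (\<lambda>n. Digamma b - (ln (real n) - (\<Sum>k<n. inverse (b + real k))))"
    by (auto simp: zb_const_err_def)
  moreover have "(\<lambda>n. Digamma b - (ln (real n) - (\<Sum>k<n. inverse (b + real k))))
      \<longlonglongrightarrow> Digamma b - Digamma b"
    using Digamma_LIMSEQ[of b] assms by (intro tendsto_intros) auto
  ultimately have "zb_const_err b 1 \<longlonglongrightarrow> 0" by simp
  from tendsto_diff[OF this zb_const_err_shift[of 1 b "N - 1"]] assms
  show ?thesis by (simp add: of_nat_diff)
qed

lemma Digamma_real_diff_le:
  assumes "0 < x" "x \<le> y" "y \<le> x + 1"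
  shows "Digamma y - Digamma x \<le> 1 / (x::real)"
  using Digamma_real_mono[of y "x + 1"] Digamma_plus1[of x] assms by simp

text \<open>After a shift, \<open>a + N\<close> lies between the integers \<open>i + N\<close> and
  \<open>i + N + 1\<close>. The sums decrease in the parameter and Digamma varies by at most
  \<open>1 / (i + N)\<close> between them, so the error is squeezed between two errors that vanish,
  up to a quantity small for large \<open>N\<close>.\<close>

lemma zb_const_err_tendsto_0:
  assumes "a > 0" "b > 0"
  shows "zb_const_err b a \<longlonglongrightarrow> 0"
proof (rule LIMSEQ_I)
  fix e :: real assume e: "e > 0"
  obtain N :: nat where N: "N > 0" "1 / real N < e / 3"
    using e reals_Archimedean[of "e/3"] by (auto simp: inverse_eq_divide)
       (metis of_nat_Suc zero_less_Suc)
  define i where "i = nat \<lfloor>a\<rfloor>"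
  have i: "real i \<le> a" "a \<le> real i + 1"
    using assms by (auto simp: i_def)
  have lim: "zb_const_err b (real (i + N)) \<longlonglongrightarrow> 0" "zb_const_err b (real (i + N + 1)) \<longlonglongrightarrow> 0"
    using N assms by (auto intro!: zb_const_err_nat simp del: of_nat_add of_nat_Suc)
  have "1 / real (i + N) \<le> 1 / real N"
    using N by (intro divide_left_mono) auto
  then have iN: "1 / real (i + N) < e / 3" using N by auto
  have "\<forall>\<^sub>F n in sequentially. \<bar>zb_const_err b a n - zb_const_err b (a + real N) n\<bar> < e / 3
     \<and> \<bar>zb_const_err b (real (i + N)) n\<bar> < e / 3 \<and> \<bar>zb_const_err b (real (i + N + 1)) n\<bar> < e / 3"
    using tendstoD[OF zb_const_err_shift[OF assms, of N], of "e/3"]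
      tendstoD[OF lim(1), of "e/3"] tendstoD[OF lim(2), of "e/3"] e
    by (auto simp: eventually_conj_iff dist_real_def)
  then have "\<forall>\<^sub>F n in sequentially. norm (zb_const_err b a n - 0) < e"
  proof eventually_elim
    case (elim n)
    have "(\<Sum>k<n. zb_term (a + real N) b k) \<le> (\<Sum>k<n. zb_term (real (i + N)) b k)"
      using N i assms by (intro sum_mono zb_term_antimono) auto
    moreover have "Digamma (a + real N) - Digamma (real (i + N)) \<le> 1 / real (i + N)"
      using N i assms by (intro Digamma_real_diff_le) auto
    ultimately have up: "zb_const_err b (a + real N) n \<le> zb_const_err b (real (i + N)) n + 1 / real (i + N)"
      by (simp add: zb_const_err_def)
    have "(\<Sum>k<n. zb_term (real (i + N + 1)) b k) \<le> (\<Sum>k<n. zb_term (a + real N) b k)"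
      using N i assms by (intro sum_mono zb_term_antimono) auto
    moreover have "Digamma (real (i + N + 1)) - Digamma (real (i + N)) \<le> 1 / real (i + N)"
      using N i assms by (intro Digamma_real_diff_le) auto
    moreover have "Digamma (real (i + N)) \<le> Digamma (a + real N)"
      using N i assms by (intro Digamma_real_mono) auto
    ultimately have "zb_const_err b (a + real N) n \<ge> zb_const_err b (real (i + N + 1)) n - 1 / real (i + N)"
      by (simp add: zb_const_err_def)
    with up elim iN show ?case unfolding real_norm_def by linarith
  qed
  then show "\<exists>no. \<forall>n\<ge>no. norm (zb_const_err b a n - 0) < e"
    by (simp add: eventually_sequentially)
qed

lemma zb_term_minus_inverse_sums:
  assumes "a > 0" "b > 0"
  shows "(\<lambda>n. zb_term a b n - 1 / real n) sums ramanujanR a b"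
proof -
  \<comment> \<open>Division by zero yields 0, so index 0 adds nothing and the sum is
    \<open>harm (n - 1)\<close>.\<close>
  have "(\<Sum>k<n. 1 / real k) = harm n - 1 / real n" for n
    by (induction n) (auto simp: harm_Suc harm_expand inverse_eq_divide)
  then have eq: "(\<Sum>k<n. zb_term a b k - 1 / real k) =
      zb_const_err b a n - (harm n - ln (real n)) + 1 / real n - Digamma a - Digamma b - euler_mascheroni" for n
    by (simp add: sum_subtractf zb_const_err_def)
  have "(\<lambda>n. zb_const_err b a n - (harm n - ln (real n)) + 1 / real n - Digamma a - Digamma b - euler_mascheroni)
    \<longlonglongrightarrow> 0 - euler_mascheroni + 0 - Digamma a - Digamma b - euler_mascheroni"
    by (intro tendsto_intros zb_const_err_tendsto_0 assms euler_mascheroni_LIMSEQ lim_1_over_n)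
  also have "0 - euler_mascheroni + 0 - Digamma a - Digamma b - euler_mascheroni = ramanujanR a b"
    by (simp add: ramanujanR_def)
  finally show ?thesis
    unfolding sums_def eq .
qed

section \<open>Convexity, barriers and power series\<close>

text \<open>Mean value theorem on both sides of the intermediate point \<open>z\<close>: the two
  slopes are values of the increasing \<open>f'\<close> at ordered points.\<close>

lemma strictly_convex_on_deriv2_pos:
  fixes f f' f'' :: "real \<Rightarrow> real"
  assumes f: "\<And>x. x \<in> {l<..<r} \<Longrightarrow> (f has_real_derivative f' x) (at x)"
    and f': "\<And>x. x \<in> {l<..<r} \<Longrightarrow> (f' has_real_derivative f'' x) (at x)"
    and pos: "\<And>x. x \<in> {l<..<r} \<Longrightarrow> f'' x > 0"
  shows "strictly_convex_on {l<..<r} f"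
proof -
  have less: "f ((1 - t) * x + t * y) < (1 - t) * f x + t * f y"
    if xy: "l < x" "x < y" "y < r" and t: "0 < t" "t < 1" for x y t
  proof -
    define z where "z = (1 - t) * x + t * y"
    have zx: "z - x = t * (y - x)" and yz: "y - z = (1 - t) * (y - x)"
      by (auto simp: z_def algebra_simps)
    have "z - x > 0" "y - z > 0" unfolding zx yz using xy t by auto
    then have z: "x < z" "z < y" by auto
    obtain \<xi> where \<xi>: "x < \<xi>" "\<xi> < z" "f z - f x = (z - x) * f' \<xi>"
      using MVT2[of x z f f'] z xy f by auto
    obtain \<eta> where \<eta>: "z < \<eta>" "\<eta> < y" "f y - f z = (y - z) * f' \<eta>"
      using MVT2[of z y f f'] z xy f by auto
    have "f' \<xi> < f' \<eta>"
    proof (rule DERIV_pos_imp_increasing[of \<xi> \<eta> f'])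
      show "\<xi> < \<eta>" using \<xi> \<eta> by auto
      fix u assume "\<xi> \<le> u" "u \<le> \<eta>"
      then have "u \<in> {l<..<r}" using \<xi> \<eta> xy by auto
      then show "\<exists>d. (f' has_real_derivative d) (at u) \<and> 0 < d"
        using f' pos by blast
    qed
    then have "(t * (1 - t) * (y - x)) * f' \<xi> < (t * (1 - t) * (y - x)) * f' \<eta>"
      using xy t by (intro mult_strict_left_mono) auto
    then have "(1 - t) * (f z - f x) < t * (f y - f z)"
      unfolding \<xi>(3) \<eta>(3) zx yz by (simp add: mult_ac)
    then show ?thesis
      unfolding z_def[symmetric] by (simp add: algebra_simps)
  qed
  show ?thesis
    unfolding strictly_convex_on_def
  proof (intro ballI impI allI)
    fix x y t :: real
    assume x: "x \<in> {l<..<r}" and y: "y \<in> {l<..<r}" and "x \<noteq> y" and t: "0 < t \<and> t < 1"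
    then consider "x < y" | "y < x" by linarith
    then show "f ((1 - t) * x + t * y) < (1 - t) * f x + t * f y"
    proof cases
      case 1
      with less[of x y t] x y t show ?thesis by auto
    next
      case 2
      with less[of y x "1 - t"] x y t show ?thesis by (auto simp: add.commute)
    qed
  qed
qed

lemma strictly_convex_on_subset:
  "strictly_convex_on S f \<Longrightarrow> T \<subseteq> S \<Longrightarrow> strictly_convex_on T f"
  unfolding strictly_convex_on_def by blast

text \<open>The two midpoint inequalities contradict each other. This yields the necessity of both
  conditions on \<open>c\<close>, by localising near an endpoint.\<close>

lemma not_strictly_convex_and_concave:
  assumes "l < r" "strictly_convex_on {l<..<r} f" "strictly_concave_on {l<..<r} f"
  shows False
proof -
  obtain x y where "l < x" "x < y" "y < r"
    using assms(1) by (meson dense)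
  then have xy: "x \<in> {l<..<r}" "y \<in> {l<..<r}" "x \<noteq> y" by auto
  then have "f ((1 - 1/2) * x + 1/2 * y) < (1 - 1/2) * f x + 1/2 * f y"
    using assms(2) unfolding strictly_convex_on_def
    by (elim ballE[of _ _ x] ballE[of _ _ y] allE[of _ "1/2"] impE) auto
  moreover have "- f ((1 - 1/2) * x + 1/2 * y) < (1 - 1/2) * - f x + 1/2 * - f y"
    using assms(3) xy unfolding strictly_concave_on_def strictly_convex_on_def
    by (elim ballE[of _ _ x] ballE[of _ _ y] allE[of _ "1/2"] impE) auto
  ultimately show False by argo
qed

text \<open>At a point where \<open>E \<ge> m\<close> the derivative is negative, so larger values
  lie just to the left. If \<open>E x \<ge> m\<close>, the maximum over \<open>{0..x}\<close> can
  therefore only be at 0.\<close>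

lemma below_barrier:
  fixes E :: "real \<Rightarrow> real"
  assumes cont: "continuous_on {0..<r} E" and "E 0 \<le> m"
    and deriv: "\<And>x. 0 < x \<Longrightarrow> x < r \<Longrightarrow> E x \<ge> m \<Longrightarrow> \<exists>d<0. (E has_real_derivative d) (at x)"
    and x: "0 < x" "x < r"
  shows "E x < m"
proof (rule ccontr)
  assume ge: "\<not> E x < m"
  have no_max: "\<exists>t\<in>{0..x}. E t > E z" if z: "0 < z" "z \<le> x" "E z \<ge> m" for z
  proof -
    obtain d where d: "d < 0" "(E has_real_derivative d) (at z)"
      using deriv[of z] z x by auto
    obtain e where e: "e > 0" "\<And>h. 0 < h \<Longrightarrow> h < e \<Longrightarrow> E z < E (z - h)"
      using DERIV_neg_dec_left[OF d(2,1)] by auto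
    \<comment> \<open>Cutting the step off at \<open>z\<close> keeps \<open>z - h\<close> in the
      interval.\<close>
    define h where "h = min (e / 2) z"
    have "E z < E (z - h)" "z - h \<in> {0..x}"
      using e z by (auto simp: h_def)
    then show ?thesis by blast
  qed
  have "\<exists>z\<in>{0..x}. \<forall>t\<in>{0..x}. E t \<le> E z"
    using x by (intro continuous_attains_sup continuous_on_subset[OF cont]) auto
  then obtain z where z: "z \<in> {0..x}" "\<And>t. t \<in> {0..x} \<Longrightarrow> E t \<le> E z" by blast
  have "z = 0"
  proof (rule ccontr)
    assume "z \<noteq> 0"
    moreover have "E z \<ge> m" using z(2)[of x] x ge by auto
    ultimately show False
      using no_max[of z] z by (auto simp: not_less[symmetric])
  qed
  \<comment> \<open>A maximum at 0 bounds \<open>E\<close> by \<open>m\<close>, so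
    \<open>E x \<ge> m\<close> would make \<open>x\<close> a maximum point too, which
    \<open>no_max\<close> excludes. Hence a weak inequality at 0 suffices for a strict
    conclusion.\<close>
  with z(2) assms(2) have "E t \<le> m" if "t \<in> {0..x}" for t
    using that by force
  with no_max[of x] ge x show False by force
qed

section \<open>Power series with bounded or summable coefficients\<close>

lemma summable_powser_bounded_coeffs:
  fixes c :: "nat \<Rightarrow> real"
  assumes "\<And>n. \<bar>c n\<bar> \<le> C" "\<bar>x\<bar> < 1"
  shows "summable (\<lambda>n. c n * x ^ n)"
proof (rule summable_comparison_test')
  show "summable (\<lambda>n. C * \<bar>x\<bar> ^ n)"
    using assms(2) by (intro summable_mult summable_geometric) auto
  show "norm (c n * x ^ n) \<le> C * \<bar>x\<bar> ^ n" for n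
    using assms(1)[of n] by (auto simp: abs_mult power_abs intro: mult_right_mono)
qed

lemma powser_ge_coeff_0:
  fixes c :: "nat \<Rightarrow> real"
  assumes "\<And>n. \<bar>c n\<bar> \<le> C" "\<And>n. c n \<ge> 0" "0 \<le> x" "x < 1"
  shows "(\<Sum>n. c n * x ^ n) \<ge> c 0"
proof -
  have "(\<Sum>n<1. c n * x ^ n) \<le> (\<Sum>n. c n * x ^ n)"
    using assms by (intro sum_le_suminf summable_powser_bounded_coeffs[of c C]) auto
  then show ?thesis by simp
qed

text \<open>Absolute summability gives uniform convergence on \<open>{0..1}\<close> by the
  Weierstrass test, so the sum is continuous up to 1.\<close>

lemma powser_tendsto_at_left_1:
  fixes c :: "nat \<Rightarrow> real"
  assumes "summable (\<lambda>n. \<bar>c n\<bar>)"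
  shows "((\<lambda>x. \<Sum>n. c n * x ^ n) \<longlongrightarrow> (\<Sum>n. c n)) (at_left 1)"
proof -
  have "uniform_limit {0..1} (\<lambda>n x. \<Sum>i<n. c i * x ^ i) (\<lambda>x. \<Sum>n. c n * x ^ n) sequentially"
  proof (rule Weierstrass_m_test)
    fix n and x :: real assume "x \<in> {0..1}"
    then have "\<bar>x\<bar> ^ n \<le> 1" by (intro power_le_one) auto
    then show "norm (c n * x ^ n) \<le> \<bar>c n\<bar>"
      by (simp add: abs_mult power_abs mult_left_le)
  qed (rule assms)
  then have "continuous_on {0..1} (\<lambda>x. \<Sum>n. c n * x ^ n)"
    by (rule uniform_limit_theorem[rotated]) (auto intro!: always_eventually continuous_intros)
  then have "((\<lambda>x. \<Sum>n. c n * x ^ n) \<longlongrightarrow> (\<Sum>n. c n * 1 ^ n)) (at 1 within {0..1})"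
    unfolding continuous_on_def by (rule bspec) auto
  then show ?thesis
    by (simp add: at_within_Icc_at_left)
qed

text \<open>The operator \<open>x d/dx\<close> multiplies the \<open>n\<close>-th coefficient by
  \<open>n\<close>; the vanishing term at 0 absorbs the index shift.\<close>

lemma x_powser_diffs:
  fixes c :: "nat \<Rightarrow> real"
  assumes "summable (\<lambda>n. diffs c n * x ^ n)"
  shows "(\<lambda>n. real n * c n * x ^ n) sums (x * (\<Sum>n. diffs c n * x ^ n))"
proof -
  have "(\<lambda>n. x * (diffs c n * x ^ n)) sums (x * (\<Sum>n. diffs c n * x ^ n))"
    using assms by (intro sums_mult summable_sums)
  then have "(\<lambda>n. real (Suc n) * c (Suc n) * x ^ Suc n) sums (x * (\<Sum>n. diffs c n * x ^ n))"
    by (simp add: diffs_def mult_ac)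
  then show ?thesis by (subst (asm) sums_Suc_iff) simp
qed

text \<open>With \<open>r = (1 - x) / x\<close>, the left-hand side is the derivative of
  \<open>h\<close> times \<open>1 - x\<close> and the square of \<open>q * w + w - 2\<close>; the
  last factor on the right is \<open>E\<close> minus the barrier value.\<close>

lemma log_ratio_deriv_identity:
  fixes p s w q r :: real
  assumes "q = r * (p * w - s)"
  shows "(q * w\<^sup>2 + (w - 2)\<^sup>2) * (1 - q * w)
           - w\<^sup>2 * (w - 2) * (r * p * (1 - q * w) - (1 + r) * q) - (q * w + w - 2)\<^sup>2
         = r * w\<^sup>2 * (q * ((s + 1 - 3 * p) * w - (2 - s)) - (s - 2 * p))"
  unfolding assms by algebra

text \<open>The left-hand side is \<open>1 - x\<close> times the derivative of \<open>E\<close>, with \<open>r = (1 - x) / x\<close>. For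
  fixed \<open>w\<close> it is, up to positive factors, affine and decreasing in the left-hand side of the last
  hypothesis, so equality there is the worst case; the result is then \<open>- z\<close> times a quadratic in
  \<open>z = p * w - s\<close> with positive coefficients.\<close>

lemma barrier_deriv_neg:
  fixes p s w q r :: real
  assumes p: "p > 0" and s: "0 < s" "s \<le> 1" and ps: "4 * p \<le> s\<^sup>2" and r: "r > 0"
    and w: "p * w > s" and q: "q = r * (p * w - s)"
    and m: "q * ((s + 1 - 3 * p) * w - (2 - s)) \<ge> s - 2 * p"
  shows "((s + 1 - 3 * p) * w - (2 - s)) * (r * p * (1 - q * w) - (1 + r) * q)
           + q * (s + 1 - 3 * p) * (1 - q * w) < 0"
proof -
  define k m where "k = s + 1 - 3 * p" and "m = s - 2 * p"
  define z where "z = p * w - s"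
  define A where "A = k * w - (2 - s)"
  have "s\<^sup>2 \<le> s" using s by (simp add: power2_eq_square mult_left_le)
  then have p4: "4 * p \<le> s" using ps by linarith
  have pos: "k > 0" "m > 0" "z > 0" "p \<le> 1/4" using p p4 s w by (auto simp: k_def m_def z_def)
  have pA: "p * A = (s + 1) * m + k * z"
    by (simp add: A_def k_def m_def z_def) algebra
  have "(s + 1) * m > 0" "k * z > 0" using pos s by auto
  then have "A > 0" using pA p by (metis add_pos_pos zero_less_mult_pos)
  define t where "t = q * A"
  have t: "t \<ge> m" using m by (simp add: t_def A_def m_def k_def)
  define X where "X = A * (p * (1 - q * w) - (1 + r) * z) + z * k * (1 - q * w)"
  have goal: "((s + 1 - 3 * p) * w - (2 - s)) * (r * p * (1 - q * w) - (1 + r) * q)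
           + q * (s + 1 - 3 * p) * (1 - q * w) = r * X"
    unfolding X_def A_def k_def z_def q by algebra
  have wpos: "w > 0" using w p s by (metis less_trans zero_less_mult_pos)
  \<comment> \<open>Multiplying by \<open>A\<close> and using \<open>r * z = q\<close> leaves
    \<open>t\<close> as the only trace of \<open>q\<close> and \<open>r\<close>.\<close>
  have "A * X = (p * A + z * k) * (A - w * t) - A\<^sup>2 * z - A * t"
    unfolding X_def t_def q z_def by algebra
  also have "\<dots> \<le> (p * A + z * k) * (A - w * m) - A\<^sup>2 * z - A * m"
  proof -
    have "(p * A + z * k) * (A - w * t) \<le> (p * A + z * k) * (A - w * m)"
      using t wpos pos p \<open>A > 0\<close> by (intro mult_left_mono) auto
    moreover have "A * m \<le> A * t" using t \<open>A > 0\<close> by auto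
    ultimately show ?thesis by linarith
  qed
  also have "\<dots> < 0"
  proof -
    define Y where "Y = (p * A + z * k) * (A - w * m) - A\<^sup>2 * z - A * m"
    have Apm: "p * (A - w * m) = m + (1 - p) * z"
      by (simp add: A_def k_def m_def z_def) algebra
    \<comment> \<open>The factor \<open>p * p\<close> lets \<open>pA\<close> and \<open>Apm\<close>
      eliminate \<open>w\<close> and \<open>A\<close> in favour of \<open>m\<close> and
      \<open>z\<close>; the part free of \<open>z\<close> then cancels.\<close>
    have "p * p * Y = p * (((s + 1) * m + 2 * (k * z)) * (m + (1 - p) * z))
        - ((s + 1) * m + k * z)\<^sup>2 * z - p * (((s + 1) * m + k * z) * m)"
    proof -
      have "p * p * Y = p * ((p * A + z * k) * (p * (A - w * m))) - (p * A)\<^sup>2 * z - p * ((p * A) * m)"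
        unfolding Y_def by algebra
      then show ?thesis unfolding Apm pA by algebra
    qed
    also have "\<dots> = - z * (m * ((s + 1)\<^sup>2 * m - p * (1 - p) * (s + 1) - p * k)
        + 2 * k * z * ((s + 1) * m - p * (1 - p)) + k\<^sup>2 * z\<^sup>2)"
      by algebra
    also have "\<dots> < 0"
    proof -
      \<comment> \<open>The bound \<open>4 * p \<le> s\<close> gives this, and it makes the two
        lower coefficients of the quadratic positive.\<close>
      have m2: "m \<ge> 2 * p" using p4 by (simp add: m_def)
      have sm: "(s + 1) * m \<ge> 2 * p"
        using mult_mono[of 1 "s + 1" "2 * p" m] m2 s p by auto
      have "p * (1 - p) \<le> p" using p pos by (simp add: mult_left_le)
      then have c2: "(s + 1) * m - p * (1 - p) > 0" using p sm by linarith
      have "(s + 1)\<^sup>2 * m \<ge> (s + 1) * (2 * p)"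
        unfolding power2_eq_square mult.assoc using sm s by (intro mult_left_mono) auto
      moreover have "p * (1 - p) * (s + 1) + p * k = (s + 1) * (2 * p) - p * p * (s + 4)"
        by (simp add: k_def) algebra
      moreover have "p * p * (s + 4) > 0" using p s by auto
      ultimately have c1: "(s + 1)\<^sup>2 * m - p * (1 - p) * (s + 1) - p * k > 0" by linarith
      have "m * ((s + 1)\<^sup>2 * m - p * (1 - p) * (s + 1) - p * k)
        + 2 * k * z * ((s + 1) * m - p * (1 - p)) + k\<^sup>2 * z\<^sup>2 > 0"
        using c1 c2 pos by (intro add_pos_pos mult_pos_pos) auto
      then show ?thesis using pos by (simp add: mult_pos_pos)
    qed
    finally show ?thesis
      unfolding Y_def[symmetric] using p by (simp add: mult_less_0_iff)
  qed
  finally have "X < 0" using \<open>A > 0\<close> by (simp add: mult_less_0_iff)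
  then show ?thesis unfolding goal using r by (simp add: mult_less_0_iff)
qed

section \<open>The zero-balanced hypergeometric function\<close>

locale zero_balanced =
  fixes a b :: real
  assumes a_pos: "a > 0" and b_pos: "b > 0" and ab_le: "a + b \<le> 1"
begin

definition p :: real where "p = a * b"
definition s :: real where "s = a + b"

text \<open>The coefficients of \<open>(1 - x) F'\<close>: by \<open>d_eq_diff\<close>, the
  increments of \<open>real n * zb_term a b n\<close>. In this form positivity and the differential
  equation are immediate.\<close>

definition d :: "nat \<Rightarrow> real" where "d n = p * zb_term a b n / (s + real n)"

definition F :: "real \<Rightarrow> real" where "F x = (\<Sum>n. zb_term a b n * x ^ n)"
definition D :: "real \<Rightarrow> real" where "D x = (\<Sum>n. d n * x ^ n)"
definition D' :: "real \<Rightarrow> real" where "D' x = (\<Sum>n. diffs d n * x ^ n)"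

section \<open>Parameters and coefficient bounds\<close>

lemma p_pos: "p > 0" and s_pos: "s > 0" and s_le: "s \<le> 1"
  using a_pos b_pos ab_le by (auto simp: p_def s_def)

lemma p_le_square: "4 * p \<le> s\<^sup>2"
  using sum_squares_bound[of a b] by (simp add: p_def s_def power2_sum)

text \<open>AM-GM combined with \<open>s \<le> 1\<close>. The positivity of \<open>\<Delta>\<close>
  and the bound \<open>w > 4\<close> rest on it.\<close>

lemma p_le: "4 * p \<le> s"
proof -
  have "s\<^sup>2 \<le> s" using s_pos s_le by (simp add: power2_eq_square mult_left_le)
  then show ?thesis using p_le_square by linarith
qed

lemmas term_pos = zb_term_pos[OF a_pos b_pos]

lemma term_le: "zb_term a b n \<le> 1 + zb_term a b 0"
proof (cases n)
  case (Suc k)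
  have "zb_term a b n \<le> real n * zb_term a b n"
    using term_pos[of n] Suc by simp
  also have "\<dots> \<le> 1" by (rule n_zb_term_le_1[OF a_pos b_pos])
  finally show ?thesis using term_pos[of 0] by simp
qed auto

lemma d_pos: "d n > 0"
  using p_pos s_pos term_pos[of n] by (simp add: d_def add_pos_nonneg)

lemma d_eq_diff: "d n = real (Suc n) * zb_term a b (Suc n) - real n * zb_term a b n"
  using sum_zb_term_div[OF a_pos b_pos, of "Suc n"] sum_zb_term_div[OF a_pos b_pos, of n]
  by (simp add: d_def p_def s_def)

text \<open>Coefficient form of the hypergeometric equation, summed up in
  \<open>x_D'\<close>.\<close>

lemma n_d_eq: "real n * d n = p * zb_term a b n - s * d n"
proof -
  have "s + real n > 0" using s_pos by auto
  then show ?thesis by (simp add: d_def divide_simps) (simp add: algebra_simps)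
qed

lemma bounded_coeffs:
  "\<bar>zb_term a b n\<bar> \<le> 1 + zb_term a b 0"
  "\<bar>d n\<bar> \<le> 1"
  "\<bar>diffs (zb_term a b) n\<bar> \<le> 1"
  "\<bar>diffs d n\<bar> \<le> p * (1 + zb_term a b 0)"
proof -
  show "\<bar>zb_term a b n\<bar> \<le> 1 + zb_term a b 0"
    using term_pos[of n] term_le[of n] by simp
  show "\<bar>d n\<bar> \<le> 1"
    using d_pos[of n] d_eq_diff[of n] n_zb_term_le_1[OF a_pos b_pos, of "Suc n"]
      mult_nonneg_nonneg[OF of_nat_0_le_iff less_imp_le[OF term_pos], of n n] by linarith
  show "\<bar>diffs (zb_term a b) n\<bar> \<le> 1"
    using n_zb_term_le_1[OF a_pos b_pos, of "Suc n"] term_pos[of "Suc n"]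
    by (simp add: diffs_def abs_mult)
  have "real (Suc n) * d (Suc n) \<le> p * zb_term a b (Suc n)"
    unfolding n_d_eq using s_pos d_pos[of "Suc n"] by simp
  also have "\<dots> \<le> p * (1 + zb_term a b 0)"
    using p_pos term_le by (intro mult_left_mono) auto
  finally show "\<bar>diffs d n\<bar> \<le> p * (1 + zb_term a b 0)"
    using d_pos[of "Suc n"] by (simp add: diffs_def abs_mult)
qed

lemmas summable_series =
  summable_powser_bounded_coeffs[of "zb_term a b", OF bounded_coeffs(1)]
  summable_powser_bounded_coeffs[of d, OF bounded_coeffs(2)]
  summable_powser_bounded_coeffs[of "diffs (zb_term a b)", OF bounded_coeffs(3)]
  summable_powser_bounded_coeffs[of "diffs d", OF bounded_coeffs(4)]

section \<open>Positivity and differential equations of \<open>F\<close> and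
  \<open>D\<close>\<close>

lemma D_0: "D 0 = d 0" and D'_0: "D' 0 = d 1"
  by (simp_all add: D_def D'_def diffs_def)

lemma F_pos: "0 \<le> x \<Longrightarrow> x < 1 \<Longrightarrow> F x > 0"
  using powser_ge_coeff_0[of "zb_term a b" _ x, OF bounded_coeffs(1) less_imp_le[OF term_pos]]
    term_pos[of 0]
  unfolding F_def by simp

lemma D_ge: "0 \<le> x \<Longrightarrow> x < 1 \<Longrightarrow> D x \<ge> d 0"
  using powser_ge_coeff_0[of d _ x, OF bounded_coeffs(2) less_imp_le[OF d_pos]]
  unfolding D_def by simp

lemma D_pos: "0 \<le> x \<Longrightarrow> x < 1 \<Longrightarrow> D x > 0"
  using D_ge[of x] d_pos[of 0] by linarith

lemma D'_pos: "0 \<le> x \<Longrightarrow> x < 1 \<Longrightarrow> D' x > 0"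
proof -
  assume x: "0 \<le> x" "x < 1"
  have "diffs d n > 0" for n using d_pos[of "Suc n"] by (simp add: diffs_def)
  then have "D' x \<ge> diffs d 0" "diffs d 0 > 0"
    using powser_ge_coeff_0[of "diffs d" _ x, OF bounded_coeffs(4)] x
    unfolding D'_def by (auto intro: less_imp_le)
  then show ?thesis by linarith
qed

lemma has_derivative_D: "\<bar>x\<bar> < 1 \<Longrightarrow> (D has_real_derivative D' x) (at x)"
  using termdiffs_strong'[of 1 d x] summable_series(2) unfolding D_def D'_def by simp

lemma isCont_D': "\<bar>x\<bar> < 1 \<Longrightarrow> isCont D' x"
  using termdiffs_strong'[of 1 "diffs d" x] summable_series(4)
  unfolding D'_def by (auto intro: DERIV_isCont)

text \<open>Multiplying the derivative of \<open>F\<close> by \<open>1 - x\<close> takes differences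
  of its coefficients, and these are \<open>d\<close> by \<open>d_eq_diff\<close>.\<close>

lemma has_derivative_F: "\<bar>x\<bar> < 1 \<Longrightarrow> (F has_real_derivative D x / (1 - x)) (at x)"
proof -
  assume x: "\<bar>x\<bar> < 1"
  let ?F' = "\<Sum>n. diffs (zb_term a b) n * x ^ n"
  have "(\<lambda>n. diffs (zb_term a b) n * x ^ n - real n * zb_term a b n * x ^ n) sums (?F' - x * ?F')"
    using summable_series(3)[OF x] by (intro sums_diff summable_sums x_powser_diffs)
  also have "(\<lambda>n. diffs (zb_term a b) n * x ^ n - real n * zb_term a b n * x ^ n) = (\<lambda>n. d n * x ^ n)"
    by (simp add: d_eq_diff diffs_def left_diff_distrib)
  finally have "D x = ?F' - x * ?F'" unfolding D_def by (simp add: sums_iff)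
  also have "\<dots> = (1 - x) * ?F'" by (simp add: algebra_simps)
  finally have "?F' = D x / (1 - x)" using x by (simp add: field_simps)
  moreover have "(F has_real_derivative ?F') (at x)"
    using termdiffs_strong'[of 1 "zb_term a b" x] summable_series(1) x unfolding F_def by simp
  ultimately show ?thesis by simp
qed

text \<open>Together with \<open>has_derivative_F\<close> this is the hypergeometric equation as a
  first-order system for \<open>F\<close> and \<open>D\<close>.\<close>

lemma x_D': "\<bar>x\<bar> < 1 \<Longrightarrow> x * D' x = p * F x - s * D x"
proof -
  assume x: "\<bar>x\<bar> < 1"
  have "(\<lambda>n. real n * d n * x ^ n) sums (x * D' x)"
    unfolding D'_def by (intro x_powser_diffs summable_series x)
  moreover have "(\<lambda>n. p * (zb_term a b n * x ^ n) - s * (d n * x ^ n)) sums (p * F x - s * D x)"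
    unfolding F_def D_def by (intro sums_diff sums_mult summable_sums summable_series x)
  moreover have "real n * d n * x ^ n = p * (zb_term a b n * x ^ n) - s * (d n * x ^ n)" for n
    unfolding n_d_eq by (simp add: algebra_simps)
  ultimately show ?thesis by (simp add: sums_iff)
qed

lemma D'_eq: "0 < x \<Longrightarrow> x < 1 \<Longrightarrow> D' x = (p * F x - s * D x) / x"
  using x_D'[of x] by (simp add: field_simps)

lemma s_D_less: "0 < x \<Longrightarrow> x < 1 \<Longrightarrow> s * D x < p * F x"
  using x_D'[of x] D'_pos[of x] mult_pos_pos[of x "D' x"] by simp

text \<open>Combines \<open>s_D_less\<close> with \<open>4 * p \<le> s\<close>. The constant 4
  leaves \<open>F - 2 * D\<close> above \<open>F / 2\<close>, which the limit at 1 uses.\<close>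

lemma D_less: "0 < x \<Longrightarrow> x < 1 \<Longrightarrow> 4 * D x < F x"
proof -
  assume x: "0 < x" "x < 1"
  have "4 * (s * D x) < 4 * p * F x" using s_D_less[OF x] by simp
  also have "\<dots> \<le> s * F x" using p_le F_pos[of x] x by (intro mult_right_mono) auto
  finally have "s * (4 * D x) < s * F x" by simp
  then show ?thesis using s_pos by simp
qed

text \<open>\<open>h - c\<close> is the factor carrying the sign of the second derivative of \<open>(c - ln (1 - x)) / F x\<close>;
  see \<open>has_derivative_quotient\<close>.\<close>

definition \<Delta> :: "real \<Rightarrow> real" where
  "\<Delta> x = F x * (1 - x) * D' x + D x * (F x - 2 * D x)"

lemma \<Delta>_pos: "0 < x \<Longrightarrow> x < 1 \<Longrightarrow> \<Delta> x > 0"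
  using F_pos[of x] D_pos[of x] D'_pos[of x] D_less[of x]
  unfolding \<Delta>_def by (intro add_pos_pos mult_pos_pos) auto

definition h :: "real \<Rightarrow> real" where
  "h x = F x * (F x - 2 * D x) / \<Delta> x + ln (1 - x)"

section \<open>The second derivative of \<open>phi_abc\<close>\<close>

lemma phi_abc_eq:
  assumes "0 < x" "x < 1"
  shows "phi_abc a b c x = Beta a b * ((c - ln (1 - x)) / F x)"
proof -
  have nz: "Beta a b \<noteq> 0"
    using a_pos b_pos by (auto simp: Beta_def intro!: Gamma_real_nonzero)
  have "(\<Sum>n. zb_term a b n * x ^ n) =
     (\<Sum>n. Beta a b * (pochhammer a n * pochhammer b n / pochhammer (a + b) n * x ^ n / fact n))"
    by (simp add: zb_term_eq_pochhammer[OF a_pos b_pos] mult_ac)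
  moreover have "summable (\<lambda>n. pochhammer a n * pochhammer b n / pochhammer (a + b) n * x ^ n / fact n)"
  proof -
    have "summable (\<lambda>n. 1 / Beta a b * (zb_term a b n * x ^ n))"
      using assms by (intro summable_mult summable_series) auto
    then show ?thesis
      using nz by (simp add: zb_term_eq_pochhammer[OF a_pos b_pos] mult_ac)
  qed
  ultimately have "F x = Beta a b * hyp2F1 a b (a + b) x"
    unfolding F_def hyp2F1_def by (simp only: suminf_mult)
  then show ?thesis
    using nz by (simp add: phi_abc_def)
qed

lemma has_derivative_quotient:
  assumes "0 < x" "x < 1"
  shows "((\<lambda>x. (c - ln (1 - x)) / F x) has_real_derivative
            (F x - (c - ln (1 - x)) * D x) / ((1 - x) * (F x)\<^sup>2)) (at x)"
    and "((\<lambda>x. (F x - (c - ln (1 - x)) * D x) / ((1 - x) * (F x)\<^sup>2)) has_real_derivative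
            \<Delta> x * (h x - c) / ((1 - x)\<^sup>2 * F x ^ 3)) (at x)"
proof -
  note [derivative_intros] =
    DERIV_chain2[OF has_derivative_F] DERIV_chain2[OF has_derivative_D]
  have F: "F x \<noteq> 0" using F_pos[of x] assms by simp
  show "((\<lambda>x. (c - ln (1 - x)) / F x) has_real_derivative
            (F x - (c - ln (1 - x)) * D x) / ((1 - x) * (F x)\<^sup>2)) (at x)"
    using assms F
    by (auto intro!: derivative_eq_intros simp: divide_simps power2_eq_square)
       (simp add: algebra_simps)?
  define G where "G = c - ln (1 - x)"
  have hc: "\<Delta> x * (h x - c) = F x * (F x - 2 * D x) - G * \<Delta> x"
    using \<Delta>_pos[OF assms] by (simp add: h_def G_def field_simps)
  have y: "1 - x \<noteq> 0" using assms by simp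
  have "((\<lambda>x. (F x - (c - ln (1 - x)) * D x) / ((1 - x) * (F x)\<^sup>2)) has_real_derivative
       ((D x / (1 - x) - (1 / (1 - x) * D x + G * D' x)) * ((1 - x) * (F x)\<^sup>2)
         - (F x - G * D x) * (- (F x)\<^sup>2 + (1 - x) * (2 * F x * (D x / (1 - x))))) /
         ((1 - x) * (F x)\<^sup>2)\<^sup>2) (at x)"
    unfolding G_def using assms F
    by (auto intro!: derivative_eq_intros simp: power2_eq_square) (simp add: algebra_simps)?
  also have "((D x / (1 - x) - (1 / (1 - x) * D x + G * D' x)) * ((1 - x) * (F x)\<^sup>2)
         - (F x - G * D x) * (- (F x)\<^sup>2 + (1 - x) * (2 * F x * (D x / (1 - x))))) /
         ((1 - x) * (F x)\<^sup>2)\<^sup>2 =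
      (F x * (F x - 2 * D x) - G * \<Delta> x) / ((1 - x)\<^sup>2 * F x ^ 3)"
  proof -
    \<comment> \<open>The two terms \<open>D x / (1 - x)\<close> in the first bracket cancel, the
      coefficient of \<open>G\<close> collects to \<open>\<Delta> x\<close>, and one factor
      \<open>F x\<close> splits off.\<close>
    have "(D x / (1 - x) - (1 / (1 - x) * D x + G * D' x)) * ((1 - x) * (F x)\<^sup>2)
         - (F x - G * D x) * (- (F x)\<^sup>2 + (1 - x) * (2 * F x * (D x / (1 - x)))) =
        F x * (F x * (F x - 2 * D x) - G * \<Delta> x)"
      using y by (simp add: \<Delta>_def) algebra
    then show ?thesis
      using F y by (simp add: power2_eq_square power3_eq_cube)
  qed
  finally show "((\<lambda>x. (F x - (c - ln (1 - x)) * D x) / ((1 - x) * (F x)\<^sup>2)) has_real_derivative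
            \<Delta> x * (h x - c) / ((1 - x)\<^sup>2 * F x ^ 3)) (at x)"
    unfolding hc .
qed

section \<open>The ratios \<open>w\<close> and \<open>q\<close>, and the monotonicity of
  \<open>h\<close>\<close>

definition w :: "real \<Rightarrow> real" where "w x = F x / D x"
definition q :: "real \<Rightarrow> real" where "q x = (1 - x) * D' x / D x"
definition E :: "real \<Rightarrow> real" where
  "E x = q x * ((s + 1 - 3 * p) * w x - (2 - s))"

lemma w_gt: "0 < x \<Longrightarrow> x < 1 \<Longrightarrow> w x > 4"
  using D_less[of x] D_pos[of x] by (simp add: w_def field_simps)

lemma p_w_gt: "0 < x \<Longrightarrow> x < 1 \<Longrightarrow> p * w x > s"
  using s_D_less[of x] D_pos[of x] by (simp add: w_def field_simps)

lemma q_eq: "0 < x \<Longrightarrow> x < 1 \<Longrightarrow> q x = (1 - x) / x * (p * w x - s)"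
  using D_pos[of x] by (simp add: q_def w_def D'_eq field_simps)

lemma q_pos: "0 < x \<Longrightarrow> x < 1 \<Longrightarrow> q x > 0"
  using D_pos[of x] D'_pos[of x] by (simp add: q_def)

lemma has_derivative_w:
  assumes "0 < x" "x < 1"
  shows "(w has_real_derivative (1 - q x * w x) / (1 - x)) (at x)"
proof -
  have D: "D x \<noteq> 0" using D_pos[of x] assms by simp
  have "(w has_real_derivative (D x / (1 - x) * D x - F x * D' x) / (D x * D x)) (at x)"
    unfolding w_def using assms D by (intro DERIV_divide has_derivative_F has_derivative_D) auto
  also have "(D x / (1 - x) * D x - F x * D' x) / (D x * D x) = (1 - q x * w x) / (1 - x)"
    using assms D by (simp add: q_def w_def divide_simps)
  finally show ?thesis .
qed

text \<open>Differentiating the form in \<open>q_eq\<close> instead of the definition avoids a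
  second derivative of \<open>D\<close>.\<close>

lemma has_derivative_q:
  assumes "0 < x" "x < 1"
  shows "(q has_real_derivative
            ((1 - x) / x * p * (1 - q x * w x) - (1 + (1 - x) / x) * q x) / (1 - x)) (at x)"
proof -
  have "((\<lambda>x. (1 - x) / x) has_real_derivative - 1 / x\<^sup>2) (at x)"
    using assms by (auto intro!: derivative_eq_intros simp: field_simps power2_eq_square)
  moreover have "((\<lambda>x. p * w x - s) has_real_derivative p * ((1 - q x * w x) / (1 - x))) (at x)"
    using has_derivative_w[OF assms] by (auto intro!: derivative_eq_intros)
  ultimately have "((\<lambda>x. (1 - x) / x * (p * w x - s)) has_real_derivative
      - 1 / x\<^sup>2 * (p * w x - s) + p * ((1 - q x * w x) / (1 - x)) * ((1 - x) / x)) (at x)"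
    by (rule DERIV_mult)
  also have "- 1 / x\<^sup>2 * (p * w x - s) + p * ((1 - q x * w x) / (1 - x)) * ((1 - x) / x) =
      ((1 - x) / x * p * (1 - q x * w x) - (1 + (1 - x) / x) * q x) / (1 - x)"
  proof -
    have "1 + (1 - x) / x = 1 / x" using assms by (simp add: field_simps)
    then have eq: "(1 + (1 - x) / x) * q x = (1 - x) * (1 / x\<^sup>2 * (p * w x - s))"
      using assms by (simp add: q_eq power2_eq_square)
    have "- 1 / t * z + p * (e / y) * (y / x) = (y / x * p * e - y * (1 / t * z)) / y"
      if "y \<noteq> 0" for t z e y
      using that by (simp add: diff_divide_distrib mult_ac)
    then show ?thesis
      unfolding eq using assms by simp
  qed
  finally show ?thesis
    using assms by (elim has_field_derivative_transform_within_open[of _ _ _ "{0<..<1}"])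
      (auto simp: q_eq)
qed

lemma isCont_series:
  assumes "\<bar>x\<bar> < 1"
  shows "isCont F x" "isCont D x"
  using has_derivative_F[OF assms] has_derivative_D[OF assms] by (auto intro: DERIV_isCont)

text \<open>The formula \<open>q_eq\<close> divides by \<open>x\<close>, so the values at 0 come
  from \<open>x_D'\<close> at 0 and from the first two coefficients of \<open>D\<close>.\<close>

lemma w_0: "w 0 = s / p" and q_0: "q 0 = p / (s + 1)"
proof -
  have pos: "D 0 > 0" using D_pos[of 0] by auto
  have "p * F 0 = s * D 0" using x_D'[of 0] by simp
  then show "w 0 = s / p"
    using pos p_pos by (simp add: w_def field_simps)
  have "zb_term a b 1 = d 0"
    using d_eq_diff[of 0] by simp
  then have "D' 0 = p * D 0 / (s + 1)"
    by (simp add: D'_0 D_0 d_def[of "Suc 0"])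
  then show "q 0 = p / (s + 1)"
    using pos by (simp add: q_def)
qed

lemma E_less:
  assumes "0 < x" "x < 1"
  shows "E x < s - 2 * p"
proof (rule below_barrier[of 1 E])
  show "continuous_on {0..<1} E"
  proof (rule continuous_at_imp_continuous_on, rule ballI)
    fix x :: real assume "x \<in> {0..<1}"
    then show "isCont E x"
      unfolding E_def q_def w_def using D_pos[of x]
      by (intro continuous_intros isCont_series isCont_D') auto
  qed
  \<comment> \<open>\<open>E\<close> starts exactly on the barrier.\<close>
  have "E 0 = s - 2 * p"
  proof -
    have "(s + 1 - 3 * p) * (s / p) - (2 - s) = (s + 1) * (s - 2 * p) / p"
      using p_pos by (simp add: field_simps)
    then show ?thesis
      using p_pos s_pos by (simp add: E_def w_0 q_0)
  qed
  then show "E 0 \<le> s - 2 * p" by simp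
  fix x :: real assume x: "0 < x" "x < 1" and ge: "s - 2 * p \<le> E x"
  define r where "r = (1 - x) / x"
  have "(E has_real_derivative
      ((r * p * (1 - q x * w x) - (1 + r) * q x) / (1 - x)) * ((s + 1 - 3 * p) * w x - (2 - s))
       + (s + 1 - 3 * p) * ((1 - q x * w x) / (1 - x)) * q x) (at x)"
    unfolding E_def r_def
    using has_derivative_q[OF x] has_derivative_w[OF x]
    by (auto intro!: derivative_eq_intros)
  also have "((r * p * (1 - q x * w x) - (1 + r) * q x) / (1 - x)) * ((s + 1 - 3 * p) * w x - (2 - s))
       + (s + 1 - 3 * p) * ((1 - q x * w x) / (1 - x)) * q x =
      (((s + 1 - 3 * p) * w x - (2 - s)) * (r * p * (1 - q x * w x) - (1 + r) * q x)
       + q x * (s + 1 - 3 * p) * (1 - q x * w x)) / (1 - x)"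
    by (simp add: add_divide_distrib mult_ac)
  finally have "(E has_real_derivative
      (((s + 1 - 3 * p) * w x - (2 - s)) * (r * p * (1 - q x * w x) - (1 + r) * q x)
       + q x * (s + 1 - 3 * p) * (1 - q x * w x)) / (1 - x)) (at x)" .
  moreover have "((s + 1 - 3 * p) * w x - (2 - s)) * (r * p * (1 - q x * w x) - (1 + r) * q x)
       + q x * (s + 1 - 3 * p) * (1 - q x * w x) < 0"
    using x ge unfolding E_def
    by (intro barrier_deriv_neg p_pos s_pos s_le p_le_square p_w_gt) (auto simp: r_def q_eq)
  ultimately show "\<exists>d<0. (E has_real_derivative d) (at x)"
    using x by (meson diff_gt_0_iff_gt divide_neg_pos)
qed (use assms in auto)

text \<open>Numerator and denominator of the quotient in \<open>h\<close> are homogeneous of degree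
  2 in \<open>F\<close>, \<open>D\<close>, \<open>D'\<close>; divide both by the square of
  \<open>D\<close>.\<close>

lemma h_eq:
  assumes "0 < x" "x < 1"
  shows "h x = w x * (w x - 2) / (q x * w x + w x - 2) + ln (1 - x)"
proof -
  have D: "D x \<noteq> 0" using D_pos[of x] assms by simp
  have "F x * (F x - 2 * D x) = (D x)\<^sup>2 * (w x * (w x - 2))"
       "\<Delta> x = (D x)\<^sup>2 * (q x * w x + w x - 2)"
    using D by (simp_all add: w_def q_def \<Delta>_def field_simps power2_eq_square)
  then show ?thesis
    using D by (simp add: h_def)
qed

lemma h_deriv_neg:
  assumes "0 < x" "x < 1"
  shows "\<exists>y. (h has_real_derivative y) (at x) \<and> y < 0"
proof -
  define r where "r = (1 - x) / x"
  define N where "N = q x * w x + w x - 2"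
  define w' where "w' = (1 - q x * w x) / (1 - x)"
  define q' where "q' = (r * p * (1 - q x * w x) - (1 + r) * q x) / (1 - x)"
  have "q x * w x > 0" using q_pos[OF assms] w_gt[OF assms] by simp
  then have N: "N > 0" using w_gt[OF assms] by (simp add: N_def)
  have "((\<lambda>x. w x * (w x - 2) / (q x * w x + w x - 2) + ln (1 - x)) has_real_derivative
      ((w' * (w x - 2) + w' * w x) * N - (w x * (w x - 2)) * (q' * w x + w' * q x + w')) / (N * N)
        - 1 / (1 - x)) (at x)"
    unfolding w'_def q'_def N_def r_def
    using has_derivative_q[OF assms] has_derivative_w[OF assms] N assms
    by (auto intro!: derivative_eq_intros simp: N_def)
  then have "(h has_real_derivative
      ((w' * (w x - 2) + w' * w x) * N - (w x * (w x - 2)) * (q' * w x + w' * q x + w')) / (N * N)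
        - 1 / (1 - x)) (at x)"
    using assms by (elim has_field_derivative_transform_within_open[of _ _ _ "{0<..<1}"])
      (auto simp: h_eq)
  also have "((w' * (w x - 2) + w' * w x) * N - (w x * (w x - 2)) * (q' * w x + w' * q x + w')) / (N * N)
        - 1 / (1 - x) = r * (w x)\<^sup>2 * (E x - (s - 2 * p)) / (N\<^sup>2 * (1 - x))"
  proof -
    have "(w' * (w x - 2) + w' * w x) * N - (w x * (w x - 2)) * (q' * w x + w' * q x + w') =
        (q x * (w x)\<^sup>2 + (w x - 2)\<^sup>2) * w' - (w x)\<^sup>2 * (w x - 2) * q'"
      unfolding N_def by algebra
    also have "\<dots> = ((q x * (w x)\<^sup>2 + (w x - 2)\<^sup>2) * (1 - q x * w x)
        - (w x)\<^sup>2 * (w x - 2) * (r * p * (1 - q x * w x) - (1 + r) * q x)) / (1 - x)"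
      unfolding w'_def q'_def by (simp only: times_divide_eq_right diff_divide_distrib[symmetric])
    \<comment> \<open>The square of \<open>N\<close> produces exactly the term that cancels the
      derivative \<open>- 1 / (1 - x)\<close> of the logarithm.\<close>
    also have "\<dots> = (N\<^sup>2 + r * (w x)\<^sup>2 * (E x - (s - 2 * p))) / (1 - x)"
    proof -
      have "q x = r * (p * w x - s)"
        using q_eq[OF assms] by (simp only: r_def)
      from log_ratio_deriv_identity[OF this] show ?thesis
        unfolding E_def N_def by (intro arg_cong[of _ _ "\<lambda>t. t / (1 - x)"]) linarith
    qed
    finally show ?thesis
      using N assms by (simp add: power2_eq_square add_divide_distrib)
  qed
  finally have "(h has_real_derivative r * (w x)\<^sup>2 * (E x - (s - 2 * p)) / (N\<^sup>2 * (1 - x))) (at x)" .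
  moreover have "r * (w x)\<^sup>2 * (E x - (s - 2 * p)) / (N\<^sup>2 * (1 - x)) < 0"
    using N assms E_less[OF assms] w_gt[OF assms]
    by (intro divide_neg_pos mult_pos_neg mult_pos_pos) (auto simp: r_def)
  ultimately show ?thesis by blast
qed

lemma h_strict_antimono:
  assumes "0 < x" "x < y" "y < 1"
  shows "h y < h x"
  using assms h_deriv_neg by (intro DERIV_neg_imp_decreasing[of x y h]) auto

section \<open>Boundary values of \<open>h\<close> at 0 and 1\<close>

lemma h_tendsto_at_right_0: "(h \<longlongrightarrow> c_ab a b) (at_right 0)"
proof -
  have pos: "D 0 > 0" using D_pos[of 0] by auto
  \<comment> \<open>The expression from \<open>h_eq\<close> extends continuously to 0, where
    \<open>w 0 \<ge> 4\<close> keeps its denominator positive; the limit is then its value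
    there.\<close>
  have "isCont (\<lambda>x. w x * (w x - 2) / (q x * w x + w x - 2) + ln (1 - x)) 0"
  proof -
    have "q 0 * w 0 + w 0 - 2 \<noteq> 0"
    proof -
      have "w 0 \<ge> 4" "q 0 > 0" using p_le p_pos s_pos by (auto simp: w_0 q_0 field_simps)
      then have "q 0 * w 0 > 0" by simp
      with \<open>w 0 \<ge> 4\<close> show ?thesis by linarith
    qed
    moreover have "isCont w 0" "isCont q 0"
      unfolding w_def q_def using pos
      by (auto intro!: continuous_intros isCont_series isCont_D')
    ultimately show ?thesis
      by (intro continuous_intros) auto
  qed
  moreover have "w 0 * (w 0 - 2) / (q 0 * w 0 + w 0 - 2) + ln (1 - 0) = c_ab a b"
  proof -
    have "w 0 * (w 0 - 2) = s * (s - 2 * p) / p\<^sup>2"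
      using p_pos by (simp add: w_0 field_simps power2_eq_square)
    moreover have "q 0 * w 0 + w 0 - 2 = ((s + 1) * (s - 2 * p) + p * s) / (p * (s + 1))"
      using p_pos s_pos by (simp add: w_0 q_0 divide_simps) (simp add: algebra_simps)
    ultimately have "w 0 * (w 0 - 2) / (q 0 * w 0 + w 0 - 2) =
       s * (s - 2 * p) * (s + 1) / (p * ((s + 1) * (s - 2 * p) + p * s))"
      using p_pos s_pos by (simp add: power2_eq_square)
    then show ?thesis by (simp add: c_ab_def p_def s_def mult_ac)
  qed
  ultimately have "((\<lambda>x. w x * (w x - 2) / (q x * w x + w x - 2) + ln (1 - x)) \<longlongrightarrow> c_ab a b) (at_right 0)"
    by (auto simp: isCont_def intro: filterlim_mono at_le)
  then show ?thesis
  proof (rule Lim_transform_eventually)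
    show "\<forall>\<^sub>F x in at_right 0. w x * (w x - 2) / (q x * w x + w x - 2) + ln (1 - x) = h x"
      using eventually_at_right_real[of 0 1] by (auto elim!: eventually_mono simp: h_eq)
  qed
qed

text \<open>Subtracting the logarithm series from \<open>F\<close> leaves the coefficients
  \<open>c\<close>, which sum to the Ramanujan constant. They are nonpositive from index 1 on, so
  convergence is absolute and passes to the limit at 1.\<close>

lemma F_plus_ln_tendsto: "((\<lambda>x. F x + ln (1 - x)) \<longlongrightarrow> ramanujanR a b) (at_left 1)"
proof -
  define c where "c n = zb_term a b n - 1 / real n" for n
  have sums: "c sums ramanujanR a b"
    unfolding c_def by (rule zb_term_minus_inverse_sums[OF a_pos b_pos])
  have c_nonpos: "c n \<le> 0" if "n > 0" for n
    using n_zb_term_le_1[OF a_pos b_pos, of n] that by (simp add: c_def field_simps)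
  have "\<forall>\<^sub>F n in sequentially. \<bar>c n\<bar> = - c n"
    using eventually_gt_at_top[of "0::nat"] by eventually_elim (simp add: c_nonpos abs_of_nonpos)
  then have "summable (\<lambda>n. \<bar>c n\<bar>)"
    using summable_minus[OF sums_summable[OF sums]] by (subst summable_cong)
  then have "((\<lambda>x. \<Sum>n. c n * x ^ n) \<longlongrightarrow> (\<Sum>n. c n)) (at_left 1)"
    by (rule powser_tendsto_at_left_1)
  then have "((\<lambda>x. \<Sum>n. c n * x ^ n) \<longlongrightarrow> ramanujanR a b) (at_left 1)"
    using sums by (simp add: sums_iff)
  then show ?thesis
  proof (rule Lim_transform_eventually)
    have "(\<Sum>n. c n * x ^ n) = F x + ln (1 - x)" if x: "0 < x" "x < 1" for x
    proof -
      have "(\<lambda>n. zb_term a b n * x ^ n + - (x ^ n) / real n) sums (F x + ln (1 - x))"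
        unfolding F_def using ln_series'[of "- x"] x
        by (intro sums_add summable_sums summable_series) auto
      moreover have "zb_term a b n * x ^ n + - (x ^ n) / real n = c n * x ^ n" for n
        by (simp add: c_def algebra_simps)
      ultimately show ?thesis by (simp add: sums_iff)
    qed
    then show "\<forall>\<^sub>F x in at_left 1. (\<Sum>n. c n * x ^ n) = F x + ln (1 - x)"
      using eventually_at_left_real[of 0 1] by (auto elim!: eventually_mono)
  qed
qed

text \<open>The partial sums telescope to \<open>real n * zb_term a b n\<close>.\<close>

lemma d_sums: "d sums 1"
  unfolding sums_def using tendsto_n_zb_term[OF a_pos b_pos]
  by (simp add: d_def p_def s_def sum_zb_term_div[OF a_pos b_pos])

lemma D_tendsto: "(D \<longlongrightarrow> 1) (at_left 1)"
proof -
  have "summable (\<lambda>n. \<bar>d n\<bar>)"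
    using d_sums d_pos by (simp add: abs_of_pos sums_iff)
  from powser_tendsto_at_left_1[OF this] show ?thesis
    using d_sums unfolding D_def by (simp add: sums_iff)
qed

lemma D_le_1: "0 \<le> x \<Longrightarrow> x < 1 \<Longrightarrow> D x \<le> 1"
proof -
  assume x: "0 \<le> x" "x < 1"
  have "(\<Sum>n. d n * x ^ n) \<le> (\<Sum>n. d n)"
    using x d_sums d_pos
    by (intro suminf_le summable_series) (auto simp: sums_iff mult_left_le power_le_one less_imp_le)
  then show ?thesis using d_sums by (simp add: D_def sums_iff)
qed

text \<open>\<open>D \<longlongrightarrow> 1\<close> alone cannot absorb the factor
  \<open>ln (1 - x)\<close>, so a rate is needed. \<open>F\<close> grows at most logarithmically,
  hence so does \<open>D'\<close>, and integrating up to 1 bounds \<open>1 - D\<close>.\<close>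

lemma bounds_near_1:
  obtains C where "\<forall>\<^sub>F x in at_left 1. F x \<le> C - ln (1 - x)"
    and "\<forall>\<^sub>F x in at_left 1. D' x \<le> 2 * p * (C - ln (1 - x))"
    and "\<forall>\<^sub>F x in at_left 1. 1 - D x \<le> 2 * p * ((1 - x) * (C + 1 - ln (1 - x)))"
proof -
  define C where "C = ramanujanR a b + 1"
  have "\<forall>\<^sub>F x in at_left 1. F x + ln (1 - x) < C"
    using F_plus_ln_tendsto by (rule order_tendstoD) (simp add: C_def)
  then have "\<forall>\<^sub>F x in at_left 1. F x \<le> C - ln (1 - x)"
    by (auto elim!: eventually_mono)
  then obtain x0 where x0: "x0 < 1" "\<And>x. x0 < x \<Longrightarrow> x < 1 \<Longrightarrow> F x \<le> C - ln (1 - x)"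
    by (auto simp: eventually_at_left[of 0 1])
  define x1 where "x1 = max x0 (1/2)"
  have F_le: "F x \<le> C - ln (1 - x)" if "x1 < x" "x < 1" for x
    using x0(2) that by (simp add: x1_def)
  have D'_le: "D' x \<le> 2 * p * (C - ln (1 - x))" if x: "x1 < x" "x < 1" for x
  proof -
    \<comment> \<open>Staying above 1/2 replaces the factor \<open>1 / x\<close> by 2.\<close>
    have x2: "1 / 2 < x" using x by (simp add: x1_def)
    have "D' x \<le> p * F x / x"
      using x2 x D_pos[of x] s_pos by (simp add: D'_eq divide_right_mono)
    also have "\<dots> \<le> 2 * p * F x"
      using x2 p_pos F_pos[of x] x by (simp add: field_simps)
    also have "\<dots> \<le> 2 * p * (C - ln (1 - x))"
      using F_le[OF x] p_pos by simp
    finally show ?thesis .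
  qed
  \<comment> \<open>The added term is the integral from \<open>x\<close> to 1 of the bound on
    \<open>D'\<close>. So \<open>g\<close> is nonincreasing with limit 1, and therefore at least
    1.\<close>
  define g where "g x = D x + 2 * p * ((1 - x) * (C + 1 - ln (1 - x)))" for x
  have g_le: "g t \<le> g x" if "x1 < x" "x \<le> t" "t < 1" for x t
  proof (rule DERIV_nonpos_imp_nonincreasing[OF that(2)])
    fix u assume u: "x \<le> u" "u \<le> t"
    have u': "x1 < u" "u < 1" "\<bar>u\<bar> < 1" using u that by (auto simp: x1_def)
    have "((\<lambda>x. (1 - x) * (C + 1 - ln (1 - x))) has_real_derivative - (C - ln (1 - u))) (at u)"
      using u' by (auto intro!: derivative_eq_intros)
    then have "(g has_real_derivative D' u + 2 * p * - (C - ln (1 - u))) (at u)"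
      unfolding g_def using u' by (intro DERIV_add DERIV_cmult has_derivative_D)
    then show "\<exists>y. (g has_real_derivative y) (at u) \<and> y \<le> 0"
      using D'_le[OF u'(1,2)] by (intro exI[of _ "D' u + 2 * p * - (C - ln (1 - u))"]) (auto simp: algebra_simps)
  qed
  have "((\<lambda>x::real. (1 - x) * (C + 1 - ln (1 - x))) \<longlongrightarrow> 0) (at_left 1)"
    by real_asymp
  then have "(g \<longlongrightarrow> 1 + 2 * p * 0) (at_left 1)"
    unfolding g_def by (intro tendsto_intros D_tendsto)
  then have g_lim: "(g \<longlongrightarrow> 1) (at_left 1)" by simp
  have g_ge: "1 \<le> g x" if x: "x1 < x" "x < 1" for x
  proof (rule tendsto_upperbound[OF g_lim])
    show "\<forall>\<^sub>F t in at_left 1. g t \<le> g x"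
      using eventually_at_left_real[OF x(2)] g_le x by (auto elim!: eventually_mono)
  qed auto
  have "x1 < 1" using x0 by (simp add: x1_def)
  note ev = eventually_at_left_real[OF this]
  show ?thesis
  proof (rule that[of C])
    show "\<forall>\<^sub>F x in at_left 1. F x \<le> C - ln (1 - x)"
      using ev by eventually_elim (use F_le in auto)
    show "\<forall>\<^sub>F x in at_left 1. D' x \<le> 2 * p * (C - ln (1 - x))"
      using ev by eventually_elim (use D'_le in auto)
    show "\<forall>\<^sub>F x in at_left 1. 1 - D x \<le> 2 * p * ((1 - x) * (C + 1 - ln (1 - x)))"
      using ev
    proof eventually_elim
      case (elim x)
      then show ?case using g_ge[of x] by (simp add: g_def)
    qed
  qed
qed

text \<open>Since \<open>\<Delta>\<close> is \<open>D * (F - 2 * D)\<close> plus a small term,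
  \<open>h\<close> equals \<open>F / D + ln (1 - x)\<close> minus the correction in fact
  \<open>2\<close>. The first part is \<open>F + ln (1 - x)\<close> plus
  \<open>(1 - D) * - ln (1 - x)\<close>, all over \<open>D\<close>.\<close>

lemma h_tendsto_at_left_1: "(h \<longlongrightarrow> ramanujanR a b) (at_left 1)"
proof -
  obtain C where F_le: "\<forall>\<^sub>F x in at_left 1. F x \<le> C - ln (1 - x)"
    and D'_le: "\<forall>\<^sub>F x in at_left 1. D' x \<le> 2 * p * (C - ln (1 - x))"
    and D_ge1: "\<forall>\<^sub>F x in at_left 1. 1 - D x \<le> 2 * p * ((1 - x) * (C + 1 - ln (1 - x)))"
    using bounds_near_1 .
  have ev: "\<forall>\<^sub>F x in at_left 1. x \<in> {0<..<1::real}"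
    by (rule eventually_at_left_real) simp
  have 1: "((\<lambda>x. (1 - D x) * - ln (1 - x)) \<longlongrightarrow> 0) (at_left 1)"
  proof (rule tendsto_sandwich[OF _ _ tendsto_const])
    show "((\<lambda>x. 2 * p * ((1 - x) * (C + 1 - ln (1 - x))) * - ln (1 - x)) \<longlongrightarrow> 0) (at_left 1)"
      using p_pos by real_asymp
    show "\<forall>\<^sub>F x in at_left 1. 0 \<le> (1 - D x) * - ln (1 - x)"
      using ev
    proof eventually_elim
      case (elim x)
      then have "1 - D x \<ge> 0" "- ln (1 - x) \<ge> 0" using D_le_1[of x] by auto
      then show ?case by (rule mult_nonneg_nonneg)
    qed
    show "\<forall>\<^sub>F x in at_left 1. (1 - D x) * - ln (1 - x) \<le>
        2 * p * ((1 - x) * (C + 1 - ln (1 - x))) * - ln (1 - x)"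
      using ev D_ge1
    proof eventually_elim
      case (elim x)
      then have "- ln (1 - x) \<ge> 0" by auto
      with elim show ?case by (intro mult_right_mono)
    qed
  qed
  have 2: "((\<lambda>x. (F x)\<^sup>2 * (1 - x) * D' x / (D x * \<Delta> x)) \<longlongrightarrow> 0) (at_left 1)"
  proof (rule tendsto_sandwich[OF _ _ tendsto_const])
    show "((\<lambda>x. 4 * p / (d 0)\<^sup>2 * ((1 - x) * (C - ln (1 - x))\<^sup>2)) \<longlongrightarrow> 0) (at_left 1)"
    proof (rule tendsto_mult_right_zero)
      show "((\<lambda>x::real. (1 - x) * (C - ln (1 - x))\<^sup>2) \<longlongrightarrow> 0) (at_left 1)"
        by real_asymp
    qed
    show "\<forall>\<^sub>F x in at_left 1. 0 \<le> (F x)\<^sup>2 * (1 - x) * D' x / (D x * \<Delta> x)"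
      using ev
    proof eventually_elim
      case (elim x)
      then show ?case
        using D_pos[of x] D'_pos[of x] \<Delta>_pos[of x]
        by (intro divide_nonneg_pos mult_nonneg_nonneg mult_pos_pos) auto
    qed
    show "\<forall>\<^sub>F x in at_left 1. (F x)\<^sup>2 * (1 - x) * D' x / (D x * \<Delta> x) \<le>
        4 * p / (d 0)\<^sup>2 * ((1 - x) * (C - ln (1 - x))\<^sup>2)"
      using ev F_le D'_le
    proof eventually_elim
      case (elim x)
      define L where "L = C - ln (1 - x)"
      have FL: "F x \<le> L" and D'L: "D' x \<le> 2 * p * L" using elim by (auto simp: L_def)
      have pos: "F x > 0" "D x > 0" "D' x > 0" "d 0 > 0" "D x \<ge> d 0" "1 - x > 0"
        using elim F_pos[of x] D_pos[of x] D'_pos[of x] d_pos D_ge[of x] by auto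
      \<comment> \<open>This lower bound cancels one factor \<open>F x\<close>, leaving
        \<open>(1 - x) * F x * D' x\<close>, which is of order \<open>1 - x\<close> times a squared
        logarithm.\<close>
      have "D x * \<Delta> x \<ge> (d 0)\<^sup>2 * (F x / 2)"
      proof -
        have "\<Delta> x \<ge> D x * (F x - 2 * D x)"
          using pos by (simp add: \<Delta>_def)
        moreover have "D x * (F x - 2 * D x) \<ge> D x * (F x / 2)"
          using D_less[of x] elim pos by (intro mult_left_mono) auto
        ultimately have "\<Delta> x \<ge> D x * (F x / 2)"
          by (rule order_trans[rotated])
        then have "D x * \<Delta> x \<ge> D x * (D x * (F x / 2))"
          using pos by (intro mult_left_mono) auto
        moreover have "D x * (D x * (F x / 2)) \<ge> d 0 * (d 0 * (F x / 2))"
          using pos by (intro mult_mono mult_nonneg_nonneg) auto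
        ultimately show ?thesis by (simp add: power2_eq_square)
      qed
      then have "(F x)\<^sup>2 * (1 - x) * D' x / (D x * \<Delta> x) \<le> (F x)\<^sup>2 * (1 - x) * D' x / ((d 0)\<^sup>2 * (F x / 2))"
        using pos elim \<Delta>_pos[of x]
        by (intro divide_left_mono mult_pos_pos mult_nonneg_nonneg) auto
      also have "\<dots> = 2 / (d 0)\<^sup>2 * ((1 - x) * (F x * D' x))"
        using pos by (simp add: power2_eq_square)
      also have "\<dots> \<le> 2 / (d 0)\<^sup>2 * ((1 - x) * (L * (2 * p * L)))"
        using pos FL D'L by (intro mult_left_mono mult_mono) auto
      also have "\<dots> = 4 * p / (d 0)\<^sup>2 * ((1 - x) * L\<^sup>2)"
        by (simp add: power2_eq_square)
      finally show ?case
        unfolding L_def .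
    qed
  qed
  have "((\<lambda>x. ((F x + ln (1 - x)) + (1 - D x) * - ln (1 - x)) / D x
          - (F x)\<^sup>2 * (1 - x) * D' x / (D x * \<Delta> x)) \<longlongrightarrow> (ramanujanR a b + 0) / 1 - 0) (at_left 1)"
    by (intro tendsto_intros F_plus_ln_tendsto 1 2 D_tendsto) auto
  then have "((\<lambda>x. ((F x + ln (1 - x)) + (1 - D x) * - ln (1 - x)) / D x
          - (F x)\<^sup>2 * (1 - x) * D' x / (D x * \<Delta> x)) \<longlongrightarrow> ramanujanR a b) (at_left 1)"
    by simp
  then show ?thesis
  proof (rule Lim_transform_eventually)
    show "\<forall>\<^sub>F x in at_left 1. ((F x + ln (1 - x)) + (1 - D x) * - ln (1 - x)) / D x
          - (F x)\<^sup>2 * (1 - x) * D' x / (D x * \<Delta> x) = h x"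
      using ev
    proof eventually_elim
      case (elim x)
      then have pos: "D x > 0" "\<Delta> x > 0" using D_pos[of x] \<Delta>_pos[of x] by auto
      have "((F x + ln (1 - x)) + (1 - D x) * - ln (1 - x)) / D x = F x / D x + ln (1 - x)"
        using pos by (simp add: field_simps)
      moreover have "F x / D x - (F x)\<^sup>2 * (1 - x) * D' x / (D x * \<Delta> x) = F x * (F x - 2 * D x) / \<Delta> x"
      proof -
        have "F x / D x = F x * \<Delta> x / (D x * \<Delta> x)"
          "F x * (F x - 2 * D x) / \<Delta> x = D x * (F x * (F x - 2 * D x)) / (D x * \<Delta> x)"
          using pos by auto
        then show ?thesis
          unfolding diff_divide_distrib[symmetric]
          by (simp only: diff_divide_distrib[symmetric]) (simp add: \<Delta>_def power2_eq_square algebra_simps)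
      qed
      ultimately show ?case by (simp add: h_def)
    qed
  qed
qed

text \<open>The limit alone gives a weak bound; an intermediate point \<open>y\<close> between
  \<open>x\<close> and 1 makes it strict.\<close>

lemma h_gt:
  assumes "0 < x" "x < 1"
  shows "h x > ramanujanR a b"
proof -
  define y where "y = (x + 1) / 2"
  have y: "x < y" "y < 1" using assms by (auto simp: y_def)
  have "\<forall>\<^sub>F t in at_left 1. h t \<le> h y"
    using eventually_at_left_real[OF y(2)] h_strict_antimono[of y] y assms
    by (auto elim!: eventually_mono intro: less_imp_le)
  then have "ramanujanR a b \<le> h y"
    using h_tendsto_at_left_1 by (intro tendsto_upperbound) auto
  with h_strict_antimono[of x y] y assms show ?thesis by simp
qed

lemma h_less:
  assumes "0 < x" "x < 1"
  shows "h x < c_ab a b"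
proof -
  define y where "y = x / 2"
  have y: "0 < y" "y < x" using assms by (auto simp: y_def)
  have "\<forall>\<^sub>F t in at_right 0. h t \<ge> h y"
    using eventually_at_right_real[OF y(1)] h_strict_antimono[of _ y] y assms
    by (auto elim!: eventually_mono intro: less_imp_le)
  then have "c_ab a b \<ge> h y"
    using h_tendsto_at_right_0 by (intro tendsto_lowerbound) auto
  with h_strict_antimono[of y x] y assms show ?thesis by simp
qed

section \<open>Convexity and concavity of \<open>phi_abc\<close>\<close>

lemma phi_abc_derivs:
  fixes x c :: real
  assumes "0 < x" "x < 1"
  defines "f' \<equiv> \<lambda>x. Beta a b * ((F x - (c - ln (1 - x)) * D x) / ((1 - x) * (F x)\<^sup>2))"
  shows "(phi_abc a b c has_real_derivative f' x) (at x)"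
    and "(f' has_real_derivative
            Beta a b * \<Delta> x / ((1 - x)\<^sup>2 * F x ^ 3) * (h x - c)) (at x)"
proof -
  have "((\<lambda>x. Beta a b * ((c - ln (1 - x)) / F x)) has_real_derivative f' x) (at x)"
    unfolding f'_def by (intro DERIV_cmult has_derivative_quotient assms)
  then show "(phi_abc a b c has_real_derivative f' x) (at x)"
    using assms by (elim has_field_derivative_transform_within_open[of _ _ _ "{0<..<1}"])
      (auto simp: phi_abc_eq)
  have "(f' has_real_derivative
      Beta a b * (\<Delta> x * (h x - c) / ((1 - x)\<^sup>2 * F x ^ 3))) (at x)"
    unfolding f'_def by (intro DERIV_cmult has_derivative_quotient assms)
  then show "(f' has_real_derivative
      Beta a b * \<Delta> x / ((1 - x)\<^sup>2 * F x ^ 3) * (h x - c)) (at x)"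
    by (simp add: mult.assoc)
qed

lemma phi_deriv2_factor_pos:
  assumes "0 < x" "x < 1"
  shows "Beta a b * \<Delta> x / ((1 - x)\<^sup>2 * F x ^ 3) > 0"
  using F_pos[of x] \<Delta>_pos[of x] assms a_pos b_pos
  by (auto intro!: divide_pos_pos mult_pos_pos simp: Beta_def)

text \<open>Stated for subintervals because the necessity proofs apply it near one endpoint.\<close>

lemma strictly_convex_phi:
  assumes "0 \<le> l" "r \<le> 1" "\<And>x. x \<in> {l<..<r} \<Longrightarrow> h x > c"
  shows "strictly_convex_on {l<..<r} (phi_abc a b c)"
proof (rule strictly_convex_on_deriv2_pos)
  fix x assume x: "x \<in> {l<..<r}"
  then have x': "0 < x" "x < 1" using assms by auto
  show "(phi_abc a b c has_real_derivative
      Beta a b * ((F x - (c - ln (1 - x)) * D x) / ((1 - x) * (F x)\<^sup>2))) (at x)"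
    by (rule phi_abc_derivs[OF x'])
  show "((\<lambda>x. Beta a b * ((F x - (c - ln (1 - x)) * D x) / ((1 - x) * (F x)\<^sup>2))) has_real_derivative
      Beta a b * \<Delta> x / ((1 - x)\<^sup>2 * F x ^ 3) * (h x - c)) (at x)"
    by (rule phi_abc_derivs[OF x'])
  show "Beta a b * \<Delta> x / ((1 - x)\<^sup>2 * F x ^ 3) * (h x - c) > 0"
    using mult_pos_pos[OF phi_deriv2_factor_pos[OF x'], of "h x - c"] assms(3)[OF x] by simp
qed

lemma strictly_concave_phi:
  assumes "0 \<le> l" "r \<le> 1" "\<And>x. x \<in> {l<..<r} \<Longrightarrow> h x < c"
  shows "strictly_concave_on {l<..<r} (phi_abc a b c)"
  unfolding strictly_concave_on_def
proof (rule strictly_convex_on_deriv2_pos)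
  fix x assume x: "x \<in> {l<..<r}"
  then have x': "0 < x" "x < 1" using assms by auto
  show "((\<lambda>x. - phi_abc a b c x) has_real_derivative
      - (Beta a b * ((F x - (c - ln (1 - x)) * D x) / ((1 - x) * (F x)\<^sup>2)))) (at x)"
    by (intro DERIV_minus phi_abc_derivs[OF x'])
  show "((\<lambda>x. - (Beta a b * ((F x - (c - ln (1 - x)) * D x) / ((1 - x) * (F x)\<^sup>2)))) has_real_derivative
      - (Beta a b * \<Delta> x / ((1 - x)\<^sup>2 * F x ^ 3) * (h x - c))) (at x)"
    by (intro DERIV_minus phi_abc_derivs[OF x'])
  show "- (Beta a b * \<Delta> x / ((1 - x)\<^sup>2 * F x ^ 3) * (h x - c)) > 0"
    using mult_pos_neg[OF phi_deriv2_factor_pos[OF x'], of "h x - c"] assms(3)[OF x] by simp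
qed

text \<open>Sufficiency is \<open>h_gt\<close>. Conversely, if \<open>c\<close> exceeds the limit of
  \<open>h\<close> at 1, then \<open>h < c\<close> near 1, so the function is strictly concave
  there, against the inherited convexity.\<close>

lemma strictly_convex_phi_iff:
  "strictly_convex_on {0<..<1} (phi_abc a b c) \<longleftrightarrow> c \<le> ramanujanR a b"
proof
  assume "c \<le> ramanujanR a b"
  then show "strictly_convex_on {0<..<1} (phi_abc a b c)"
    using h_gt by (intro strictly_convex_phi) (auto intro: le_less_trans)
next
  assume convex: "strictly_convex_on {0<..<1} (phi_abc a b c)"
  show "c \<le> ramanujanR a b"
  proof (rule ccontr)
    assume "\<not> c \<le> ramanujanR a b"
    then have "\<forall>\<^sub>F x in at_left 1. h x < c"
      using order_tendstoD(2)[OF h_tendsto_at_left_1, of c] by simp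
    then obtain x0 where x0: "x0 < 1" "\<And>x. x0 < x \<Longrightarrow> x < 1 \<Longrightarrow> h x < c"
      by (auto simp: eventually_at_left[of 0 1])
    \<comment> \<open>\<open>x0\<close> may be negative; the maximum keeps the interval inside
      \<open>{0<..<1}\<close>.\<close>
    define l where "l = max x0 0"
    have l: "0 \<le> l" "l < 1" "x0 \<le> l" using x0 by (auto simp: l_def)
    have "strictly_concave_on {l<..<1} (phi_abc a b c)"
      using l x0 by (intro strictly_concave_phi) auto
    moreover have "strictly_convex_on {l<..<1} (phi_abc a b c)"
      using convex l by (elim strictly_convex_on_subset) auto
    ultimately show False
      using not_strictly_convex_and_concave l by blast
  qed
qed

text \<open>The mirror argument at 0: if \<open>c\<close> is below the limit of \<open>h\<close>
  there, the function is strictly convex near 0.\<close>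

lemma strictly_concave_phi_iff:
  "strictly_concave_on {0<..<1} (phi_abc a b c) \<longleftrightarrow> c_ab a b \<le> c"
proof
  assume "c_ab a b \<le> c"
  then show "strictly_concave_on {0<..<1} (phi_abc a b c)"
    using h_less by (intro strictly_concave_phi) (auto intro: less_le_trans)
next
  assume concave: "strictly_concave_on {0<..<1} (phi_abc a b c)"
  show "c_ab a b \<le> c"
  proof (rule ccontr)
    assume "\<not> c_ab a b \<le> c"
    then have "\<forall>\<^sub>F x in at_right 0. h x > c"
      using order_tendstoD(1)[OF h_tendsto_at_right_0, of c] by simp
    then obtain x0 where x0: "0 < x0" "\<And>x. 0 < x \<Longrightarrow> x < x0 \<Longrightarrow> h x > c"
      by (auto simp: eventually_at_right[of 0 1])
    define r where "r = min x0 1"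
    have r: "0 < r" "r \<le> 1" "r \<le> x0" using x0 by (auto simp: r_def)
    have "strictly_convex_on {0<..<r} (phi_abc a b c)"
      using r x0 by (intro strictly_convex_phi) auto
    moreover have "strictly_concave_on {0<..<r} (phi_abc a b c)"
      using concave r unfolding strictly_concave_on_def
      by (elim strictly_convex_on_subset) auto
    ultimately show False
      using not_strictly_convex_and_concave r by blast
  qed
qed

end

theorem theorem1:
  fixes a b c :: real
  assumes "a > 0" and "b > 0" and "a + b \<le> 1" and "c \<ge> 0"
  shows "(strictly_convex_on {0<..<1} (phi_abc a b c) \<longleftrightarrow> c \<le> ramanujanR a b)
       \<and> (strictly_concave_on {0<..<1} (phi_abc a b c) \<longleftrightarrow> c \<ge> c_ab a b)"
proof -
  interpret zero_balanced a b
    using assms by unfold_locales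
  show ?thesis
    using strictly_convex_phi_iff strictly_concave_phi_iff by blast
qed

end
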